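(* Let $n\geq 2$ and let $f=1^{x_{1}}0^{y_{1}}1^{x_{2}}0^{y_{2}}\cdots 1^{x_{n}}0^{y_{n}}$ with integers $x_i\geq 1$, $y_i\geq 1$ for $i=1,\ldots,n$. If $x_{n}\geq x_{1}+1$ and $y_{1}=y_{n}$, then $Q_{d}(f)\not\hookrightarrow Q_{d}$ for all $d\geq 2\sum_{i=2}^{n}x_{i}+2\sum_{i=2}^{n-1}y_{i}+3y_{1}+x_{1}-1$ (an empty sum being $0$).
   Context: All strings are binary; $1^a$ (resp. $0^a$) denotes the string of $a$ consecutive ones (resp. zeros), and juxtaposition is concatenation. $Q_d$ is the $d$-dimensional hypercube: its vertices are the binary strings of length $d$, two being adjacent iff they differ in exactly one bit. A string $f$ is a factor of $\mu$ if $f$ appears as $|f|$ consecutive bits of $\mu$. The generalized Fibonacci cube $Q_d(f)$ is the subgraph of $Q_d$ induced by all strings of length $d$ that do not contain $f$ as a factor. A subgraph $H$ of a connected graph $G$ is an isometric subgraph, written $H\hookrightarrow G$ (and $H\not\hookrightarrow G$ otherwise), if $d_H(\mu,\nu)=d_G(\mu,\nu)$ for all $\mu,\nu\in V(H)$ (with $d_H=\infty$ for vertices in different components of $H$). *)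

theory Defs
  imports "Graph_Theory.Graph_Theory" "HOL-Library.Sublist"
begin

text \<open>
  Binary strings are lists of type \<^typ>\<open>bool list\<close>, with \<^const>\<open>True\<close> for the bit 1 and
  \<^const>\<open>False\<close> for the bit 0. Undirected graphs are symmetric digraphs, as is usual in
  the \<open>Graph_Theory\<close> library: an edge is represented by its two orientations.
\<close>

definition hypercube :: "nat \<Rightarrow> (bool list, bool list \<times> bool list) pre_digraph" where
  "hypercube d = with_proj
     \<lparr> pverts = {u. length u = d},
       parcs = {(u, v). length u = d \<and> length v = d \<and> card {i. i < d \<and> u ! i \<noteq> v ! i} = 1} \<rparr>"

definition fibonacci_cube ::
  "nat \<Rightarrow> bool list \<Rightarrow> (bool list, bool list \<times> bool list) pre_digraph" where
  "fibonacci_cube d f = hypercube d \<restriction> {u. length u = d \<and> \<not> sublist f u}"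

text \<open>
  \<^term>\<open>wf_digraph.\<mu> G c u v\<close> is the infimum in \<^typ>\<open>ereal\<close> of the costs of the walks from
  \<open>u\<close> to \<open>v\<close>. With unit costs it is the usual graph distance, equal to \<open>\<infinity>\<close> when there is no
  such walk.
\<close>

definition graph_dist :: "('a, 'b) pre_digraph \<Rightarrow> 'a \<Rightarrow> 'a \<Rightarrow> ereal" where
  "graph_dist G u v = wf_digraph.\<mu> G (\<lambda>_. 1) u v"

definition isometric_subgraph :: "('a, 'b) pre_digraph \<Rightarrow> ('a, 'b) pre_digraph \<Rightarrow> bool" where
  "isometric_subgraph H G \<longleftrightarrow> subgraph H G \<and>
     (\<forall>u \<in> verts H. \<forall>v \<in> verts H. graph_dist H u v = graph_dist G u v)"

definition block_string :: "nat \<Rightarrow> (nat \<Rightarrow> nat) \<Rightarrow> (nat \<Rightarrow> nat) \<Rightarrow> bool list" where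
  "block_string n x y =
     concat (map (\<lambda>i. replicate (x i) True @ replicate (y i) False) [1..<Suc n])"

text \<open>
  The distance \<^const>\<open>wf_digraph.\<mu>\<close> is specified only for well-formed graphs, and
  \<^const>\<open>isometric_subgraph\<close> includes the subgraph relation. The following facts show that
  for the cubes both side conditions hold, so that a failure of \<^const>\<open>isometric_subgraph\<close>
  is a failure of the equality of distances.
\<close>

lemma graph_hypercube: "graph (hypercube d)"
proof -
  let ?V = "{u::bool list. length u = d}"
  let ?A = "{(u::bool list, v). length u = d \<and> length v = d \<and> card {i. i < d \<and> u ! i \<noteq> v ! i} = 1}"
  have fin: "finite ?V"
    using finite_lists_length_eq[of "UNIV :: bool set" d] by simp
  have finA: "finite ?A"
    by (rule finite_subset[OF _ finite_cartesian_product[OF fin fin]]) blast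
  have "{i. i < d \<and> v ! i \<noteq> u ! i} = {i. i < d \<and> u ! i \<noteq> v ! i}"
    for u v :: "bool list" by blast
  then have symA: "sym ?A"
    by (simp add: sym_def)
  interpret pair_graph "\<lparr> pverts = ?V, parcs = ?A \<rparr>"
  proof
    fix e assume "e \<in> parcs \<lparr> pverts = ?V, parcs = ?A \<rparr>"
    then have e: "e \<in> ?A" by simp
    show "fst e \<in> pverts \<lparr> pverts = ?V, parcs = ?A \<rparr>"
      and "snd e \<in> pverts \<lparr> pverts = ?V, parcs = ?A \<rparr>"
      using e by (simp_all add: case_prod_unfold)
    show "fst e \<noteq> snd e"
    proof
      assume "fst e = snd e"
      then show False using e by (simp add: case_prod_unfold)
    qed
  next
    show "symmetric (with_proj \<lparr> pverts = ?V, parcs = ?A \<rparr>)"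
      using symA by (simp add: symmetric_def)
  next
    show "finite (pverts \<lparr> pverts = ?V, parcs = ?A \<rparr>)"
      using fin by simp
  next
    show "finite (parcs \<lparr> pverts = ?V, parcs = ?A \<rparr>)"
      using finA by simp
  qed
  show ?thesis
    unfolding hypercube_def by (rule pair_graphD_graph)
qed

lemma induced_subgraph_fibonacci_cube: "induced_subgraph (fibonacci_cube d f) (hypercube d)"
proof -
  interpret graph "hypercube d" by (rule graph_hypercube)
  have "{u. length u = d \<and> \<not> sublist f u} \<subseteq> verts (hypercube d)"
    by (simp add: hypercube_def Collect_mono)
  then show ?thesis
    unfolding fibonacci_cube_def by (rule induced_induce)
qed

lemma isometric_subgraph_fibonacci_cube_iff:
  "isometric_subgraph (fibonacci_cube d f) (hypercube d) \<longleftrightarrow>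
     (\<forall>u \<in> verts (fibonacci_cube d f). \<forall>v \<in> verts (fibonacci_cube d f).
        graph_dist (fibonacci_cube d f) u v = graph_dist (hypercube d) u v)"
  using induced_subgraph_fibonacci_cube[of d f]
  by (auto simp: isometric_subgraph_def induced_subgraph_def)

end

theory Submission
  imports Defs
begin

text \<open>
  Write \<open>a\<close> for \<open>x 1\<close> and \<open>b\<close> for \<open>y 1 = y n\<close>. The word \<open>f\<close> begins with
  \<open>1\<^sup>a 0\<^sup>b 1\<close> and ends with \<open>1\<^sup>a 1 0\<^sup>b\<close>, two words that differ in exactly two bits. Overlap
  two copies of \<open>f\<close> in these \<open>a + b + 1\<close> letters: of the four words obtained by choosing the
  two conflicting bits, two contain \<open>f\<close>, and counting ones shows that the other two, obtained
  by choosing both bits equal, do not. These two are at distance 2 in the hypercube, but no path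
  of length 2 joins them in the Fibonacci cube. Since \<open>f\<close> ends with 0, this remains true when
  ones are appended to all four words.
\<close>

section \<open>Graph distance at most 2 in terms of arcs\<close>

lemma graph_dist_le_2I:
  assumes "wf_digraph G" "e \<in> arcs G" "e' \<in> arcs G" "head G e = tail G e'"
  shows "graph_dist G (tail G e) (head G e') \<le> 2"
proof -
  interpret wf_digraph G by fact
  have "awalk (tail G e) [e, e'] (head G e')"
    using assms by (simp add: awalk_def)
  from min_cost_le_walk_cost[OF this, of "\<lambda>_. 1"] show ?thesis
    by (simp add: graph_dist_def awalk_cost_def)
qed

lemma graph_dist_le_2E:
  assumes "wf_digraph G" "graph_dist G u v \<le> 2"
  obtains "u = v"
  | e where "e \<in> arcs G" "tail G e = u" "head G e = v"
  | e e' where "e \<in> arcs G" "e' \<in> arcs G" "tail G e = u" "head G e = tail G e'" "head G e' = v"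
proof -
  interpret wf_digraph G by fact
  \<comment> \<open>Any bound strictly between 2 and 3 works: an infimum strictly below it yields an
    actual walk, whose length is an integer and thus at most 2.\<close>
  have "(INF p\<in>{p. awalk u p v}. ereal (awalk_cost (\<lambda>_. 1) p)) < ereal (5/2)"
    using assms(2) unfolding graph_dist_def \<mu>_def by (rule le_less_trans) simp
  then obtain p where p: "awalk u p v" "awalk_cost (\<lambda>_. 1) p < 5/2"
    unfolding INF_less_iff by auto
  have "awalk_cost (\<lambda>_. 1) q = real (length q)" for q :: "'b list"
    by (induction q) (auto simp: awalk_cost_def)
  with p have "length p \<le> 2" by simp
  then consider "p = []" | e where "p = [e]" | e e' where "p = [e, e']"
    by (cases p rule: remdups_adj.cases) auto
  then show ?thesis
    using p(1) that by cases (auto simp: awalk_def)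
qed

section \<open>Bit flips in the cubes\<close>

lemma verts_fibonacci_cube: "verts (fibonacci_cube d f) = {u. length u = d \<and> \<not> sublist f u}"
  by (simp add: fibonacci_cube_def)

lemma arcs_hypercube:
  "arcs (hypercube d) =
     {(u, v). length u = d \<and> length v = d \<and> card {i. i < d \<and> u ! i \<noteq> v ! i} = 1}"
  by (simp add: hypercube_def)

lemma tail_hypercube [simp]: "tail (hypercube d) = fst"
  and head_hypercube [simp]: "head (hypercube d) = snd"
  by (simp_all add: hypercube_def)

lemma arcs_fibonacci_cube:
  "arcs (fibonacci_cube d f) =
     {(u, v). (u, v) \<in> arcs (hypercube d) \<and> \<not> sublist f u \<and> \<not> sublist f v}"
  by (auto simp: fibonacci_cube_def arcs_hypercube)

lemma tail_fibonacci_cube [simp]: "tail (fibonacci_cube d f) = fst"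
  and head_fibonacci_cube [simp]: "head (fibonacci_cube d f) = snd"
  by (simp_all add: fibonacci_cube_def)

text \<open>A path of length 2 between the words with equal bits flips the two positions one after
  the other, so its midpoint is one of the mixed words, and both contain \<open>f\<close>.\<close>

lemma not_isometric_fibonacci_cubeI:
  assumes FF: "\<not> sublist f (A @ False # B @ False # C)"
    and TT: "\<not> sublist f (A @ True # B @ True # C)"
    and TF: "sublist f (A @ True # B @ False # C)"
    and FT: "sublist f (A @ False # B @ True # C)"
    and d: "d = length A + length B + length C + 2"
  shows "\<not> isometric_subgraph (fibonacci_cube d f) (hypercube d)"
proof
  assume iso: "isometric_subgraph (fibonacci_cube d f) (hypercube d)"
  define p q where "p = length A" and "q = Suc (length A + length B)"
  define w where "w s t = A @ s # B @ t # C" for s t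
  have len: "length (w s t) = d" for s t
    by (simp add: w_def d)
  have wp: "w s t ! p = s" for s t
    by (simp add: w_def p_def)
  have wq: "w s t ! q = t" for s t
    by (simp add: w_def q_def nth_append)
  have upd: "(w s t)[p := s'] = w s' t" "(w s t)[q := t'] = w s t'" for s t s' t'
    by (simp_all add: w_def p_def q_def list_update_append)
  have pq: "p < q" "q < d"
    by (simp_all add: p_def q_def d)
  interpret Q: graph "hypercube d" by (rule graph_hypercube)
  have sub: "subgraph (fibonacci_cube d f) (hypercube d)"
    using iso by (simp add: isometric_subgraph_def)
  then have wfF: "wf_digraph (fibonacci_cube d f)"
    by (simp add: subgraph_def)
  have single: "u[i := v ! i] = v"
    if "(u, v) \<in> arcs (hypercube d)" "i < d" "u ! i \<noteq> v ! i" for u v i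
  proof -
    have l: "length u = d" "length v = d" and "card {j. j < d \<and> u ! j \<noteq> v ! j} = 1"
      using that(1) by (auto simp: arcs_hypercube)
    then obtain k where k: "{j. j < d \<and> u ! j \<noteq> v ! j} = {k}"
      by (auto simp: card_1_singleton_iff)
    have "i = k" using that(2,3) k by blast
    then have "u ! j = v ! j" if "j < d" "j \<noteq> i" for j
      using that k by blast
    then show ?thesis
      using l by (intro nth_equalityI) (simp_all, metis nth_list_update_eq nth_list_update_neq)
  qed
  have arc: "(u, u[i := b]) \<in> arcs (hypercube d)"
    if "length u = d" "i < d" "u ! i \<noteq> b" for u i b
  proof -
    have "{j. j < d \<and> u ! j \<noteq> u[i := b] ! j} = {i}"
      using that by (auto simp: nth_list_update)
    then show ?thesis using that by (simp add: arcs_hypercube)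
  qed
  have "(w False False, w True False) \<in> arcs (hypercube d)"
    "(w True False, w True True) \<in> arcs (hypercube d)"
    using arc[of "w False False" p True] arc[of "w True False" q True] pq
    by (simp_all add: len wp wq upd)
  from graph_dist_le_2I[OF Q.wf_digraph_axioms this]
  have "graph_dist (hypercube d) (w False False) (w True True) \<le> 2"
    by simp
  then have "graph_dist (fibonacci_cube d f) (w False False) (w True True) \<le> 2"
    using iso FF TT len
    by (simp add: isometric_subgraph_fibonacci_cube_iff verts_fibonacci_cube flip: w_def)
  with wfF show False
  proof (cases rule: graph_dist_le_2E)
    case 1
    then show False by (simp add: w_def)
  next
    case (2 e)
    then have "(w False False, w True True) \<in> arcs (hypercube d)"
      by (cases e) (auto simp: arcs_fibonacci_cube)
    from single[OF this, of p] have "w True False = w True True"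
      using pq by (simp add: wp upd)
    then show False by (simp add: w_def)
  next
    case (3 e e')
    define m where "m = snd e"
    have m: "(w False False, m) \<in> arcs (hypercube d)" "(m, w True True) \<in> arcs (hypercube d)"
      "\<not> sublist f m"
      using 3 by (cases e; cases e'; auto simp: arcs_fibonacci_cube m_def)+
    show False
    proof (cases "m ! p")
      case True
      with single[OF m(1), of p] have "m = w True False"
        using pq by (simp add: wp upd)
      then show False using m(3) TF by (simp add: w_def)
    next
      case False
      \<comment> \<open>Here the second arc flips bit \<open>p\<close>. It is reversed so that
        \<open>single\<close> gives \<open>m\<close> as an update of the known word
        \<open>w True True\<close>.\<close>
      have "{i. i < d \<and> w True True ! i \<noteq> m ! i} = {i. i < d \<and> m ! i \<noteq> w True True ! i}"
        by auto
      with m(2) have m': "(w True True, m) \<in> arcs (hypercube d)"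
        by (simp only: arcs_hypercube mem_Collect_eq prod.case)
      with False single[OF m', of p] have "m = w False True"
        using pq by (simp add: wp upd)
      then show False using m(3) FT by (simp add: w_def)
    qed
  qed
qed

section \<open>Occurrences of a word in its overlap with itself\<close>

lemma count_list_replicate: "count_list (replicate n a) b = (if a = b then n else 0)"
  by (induction n) auto

text \<open>
  If \<open>f\<close> occurs in \<open>w @ v\<close> after \<open>s\<close> and its first letters \<open>g\<close> are also letters of a copy of
  \<open>f\<close> that starts at the beginning, then \<open>s\<close> and the equally long block of \<open>f\<close> that follows the
  prefix \<open>g\<close> contain the same letters.
\<close>

lemma count_list_eq_if_shifted_prefix:
  assumes f: "f = g @ v" and occ: "s @ f @ t = w @ v" and len: "length w = length f"
    and pre: "prefix (s @ g) f"
  shows "count_list w c = count_list f c"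
proof -
  have l: "length s + length t = length v"
    using arg_cong[OF occ, of length] len by simp
  have "drop (length s) v = t"
    using arg_cong[OF occ, of "drop (length f + length s)"] len by simp
  then have v: "v = take (length s) v @ t"
    by (metis append_take_drop_id)
  obtain r where "f = (s @ g) @ r"
    using pre by (auto simp: prefix_def)
  then have "(g @ take (length s) v) @ t = (s @ g) @ r"
    using f v by simp
  then have "g @ take (length s) v = s @ g"
    using l by (subst (asm) append_eq_append_conv) auto
  then have "count_list (g @ take (length s) v) c = count_list (s @ g) c"
    by simp
  \<comment> \<open>Cancelling \<open>g\<close> gives \<open>s\<close> and
    \<open>take (length s) v\<close> equal counts, and \<open>t\<close> is the rest of
    \<open>v\<close>. Hence \<open>s\<close> and \<open>t\<close> together balance \<open>v\<close>
    in \<open>occ\<close>.\<close>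
  then have "count_list s c + count_list t c = count_list v c"
    using arg_cong[OF v, of "\<lambda>w. count_list w c"] by simp
  then show ?thesis
    using arg_cong[OF occ, of "\<lambda>w. count_list w c"] by simp
qed

context
  fixes f u v :: "bool list" and a z :: nat
  assumes suffix_f: "f = u @ replicate a True @ True # replicate z False @ [False]"
    and prefix_f: "f = replicate a True @ False # replicate z False @ True # v"
begin

lemma length_u: "length u = length v"
  using arg_cong[OF trans[OF suffix_f[symmetric] prefix_f], of length] by simp

text \<open>In both uses below, \<open>w\<close> is \<open>f\<close> with a single bit flipped, so
  equal numbers of ones are absurd.\<close>

lemma shifted_prefix_imp_count_eq:
  assumes "s @ f @ t = w @ v" "length w = length f"
    and "prefix (s @ replicate a True @ False # replicate z False @ [True]) f"
  shows "count_list w True = count_list f True"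
  by (rule count_list_eq_if_shifted_prefix[OF _ assms]) (simp add: prefix_f)

text \<open>Follow the first 1 after the opening zeros of a supposed copy of \<open>f\<close>. If it
  lies before the flipped bit, the counting argument applies; otherwise it falls on one of the
  \<open>z + 2\<close> consecutive zeros.\<close>

lemma not_sublist_False_False:
  "\<not> sublist f (u @ replicate a True @ False # replicate z False @ False # v)"
proof
  define w where "w = u @ replicate a True @ False # replicate z False @ [False]"
  assume "sublist f (u @ replicate a True @ False # replicate z False @ False # v)"
  then obtain s t where occ: "s @ f @ t = w @ v"
    by (auto simp: sublist_def w_def)
  have lw: "length w = length f"
    by (simp add: w_def suffix_f)
  have le: "length s \<le> length v"
    using arg_cong[OF occ, of length] lw by simp
  let ?g = "replicate a True @ False # replicate z False @ [True]"
  have "w @ v = (s @ ?g) @ v @ t"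
    using occ by (simp add: prefix_f)
  then have nth: "(w @ v) ! i = (s @ ?g) ! i" if "i < length s + a + z + 2" for i
    using that unfolding \<open>w @ v = _\<close> by (subst nth_append) simp
  show False
  proof (cases "length s + z + 1 < length v")
    case True
    have "prefix (s @ ?g) (w @ v)"
      unfolding \<open>w @ v = _\<close> by simp
    moreover have "prefix (u @ replicate a True) (w @ v)"
      by (simp add: w_def)
    ultimately have "prefix (s @ ?g) (u @ replicate a True)"
      by (rule prefix_length_prefix) (use True length_u in simp)
    then have "prefix (s @ ?g) f"
      unfolding suffix_f by (metis append.assoc prefix_prefix)
    from shifted_prefix_imp_count_eq[OF occ lw this] show False
      by (simp add: w_def suffix_f count_list_replicate)
  next
    case False
    let ?i = "length s + a + z + 1"
    have "w @ v = (u @ replicate a True) @ replicate (z + 2) False @ v"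
      by (simp add: w_def replicate_append_same)
    then have "(w @ v) ! ?i = (replicate (z + 2) False @ v) ! (?i - (length u + a))"
      using False length_u by (simp add: nth_append)
    moreover have "?i - (length u + a) < z + 2"
      using le length_u by simp
    ultimately have "\<not> (w @ v) ! ?i"
      by (simp only: nth_append length_replicate if_True nth_replicate not_False_eq_True)
    moreover have "(w @ v) ! ?i"
      by (subst nth) (simp_all add: nth_append nth_Cons')
    ultimately show False by simp
  qed
qed

text \<open>A copy starting before position \<open>length u\<close> has its opening part to the left
  of the flipped last bit of \<open>w\<close>, so counting applies. A copy starting at
  \<open>length u\<close> needs a 0 where the first chosen bit is 1.\<close>

lemma not_sublist_True_True:
  "\<not> sublist f (u @ replicate a True @ True # replicate z False @ True # v)"
proof
  define w where "w = u @ replicate a True @ True # replicate z False @ [True]"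
  assume "sublist f (u @ replicate a True @ True # replicate z False @ True # v)"
  then obtain s t where occ: "s @ f @ t = w @ v"
    by (auto simp: sublist_def w_def)
  have lw: "length w = length f"
    by (simp add: w_def suffix_f)
  have le: "length s \<le> length v"
    using arg_cong[OF occ, of length] lw by simp
  let ?g = "replicate a True @ False # replicate z False @ [True]"
  have "w @ v = s @ ?g @ v @ t"
    using occ by (simp add: prefix_f)
  show False
  proof (cases "length s < length v")
    case True
    let ?u = "u @ replicate a True @ True # replicate z False"
    have "prefix (s @ ?g) (w @ v)"
      unfolding \<open>w @ v = _\<close> by simp
    moreover have "prefix ?u (w @ v)"
      by (simp add: w_def)
    ultimately have "prefix (s @ ?g) ?u"
      by (rule prefix_length_prefix) (use True length_u in simp)
    then have "prefix (s @ ?g) f"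
      by (rule prefix_order.trans) (simp add: suffix_f)
    from shifted_prefix_imp_count_eq[OF occ lw this] show False
      by (simp add: w_def suffix_f count_list_replicate)
  next
    case False
    with le length_u have "length s = length u" by simp
    with \<open>w @ v = _\<close> show False
      by (simp add: w_def)
  qed
qed

end

text \<open>An occurrence of a word ending in 0 cannot end among the appended ones.\<close>

lemma sublist_append_replicate_True:
  "sublist (g @ [False]) (w @ replicate k True) \<longleftrightarrow> sublist (g @ [False]) w"
proof (induction k)
  case (Suc k)
  have "sublist (g @ [False]) ((w @ replicate k True) @ [True]) \<longleftrightarrow>
      sublist (g @ [False]) (w @ replicate k True)"
    by (simp add: sublist_snoc suffix_def del: append_assoc)
  with Suc show ?case
    by (simp add: replicate_append_same)
qed simp

text \<open>The overlapped words have length \<open>length f + length v\<close>; larger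
  \<open>d\<close> are reached by appending ones.\<close>

lemma not_isometric_fibonacci_cube_overlap:
  assumes suffix_f: "f = u @ replicate a True @ True # replicate z False @ [False]"
    and prefix_f: "f = replicate a True @ False # replicate z False @ True # v"
    and d: "length f + length v \<le> d"
  shows "\<not> isometric_subgraph (fibonacci_cube d f) (hypercube d)"
proof -
  define k where "k = d - (length f + length v)"
  let ?w = "\<lambda>s t. u @ replicate a True @ s # replicate z False @ t # v"
  have app: "sublist f (?w s t @ replicate k True) \<longleftrightarrow> sublist f (?w s t)" for s t
    using sublist_append_replicate_True
      [of "u @ replicate a True @ True # replicate z False" "?w s t" k]
    by (simp add: suffix_f)
  have "sublist f (?w True False)"
    using sublist_append_rightI[of f v] by (simp add: suffix_f)
  moreover have "sublist f (?w False True)"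
    using sublist_append_leftI[of f u] by (simp add: prefix_f)
  moreover note not_sublist_False_False[OF suffix_f prefix_f]
    not_sublist_True_True[OF suffix_f prefix_f]
  moreover have "d = length u + a + z + (length v + k) + 2"
    using d by (simp add: k_def suffix_f)
  ultimately show ?thesis
    using app
    by (intro not_isometric_fibonacci_cubeI
      [where A = "u @ replicate a True" and B = "replicate z False" and C = "v @ replicate k True"])
      simp_all
qed

theorem lemma2p4:
  fixes n d :: nat and x y :: "nat \<Rightarrow> nat"
  assumes "n \<ge> 2"
    and "\<And>i. i \<in> {1..n} \<Longrightarrow> x i \<ge> 1"
    and "\<And>i. i \<in> {1..n} \<Longrightarrow> y i \<ge> 1"
    and "x n \<ge> x 1 + 1"
    and "y 1 = y n"
    and "d \<ge> 2 * (\<Sum>i=2..n. x i) + 2 * (\<Sum>i=2..n - 1. y i) + 3 * y 1 + x 1 - 1"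
  shows "\<not> isometric_subgraph (fibonacci_cube d (block_string n x y)) (hypercube d)"
proof -
  let ?block = "\<lambda>i. replicate (x i) True @ replicate (y i) False"
  define M where "M = concat (map ?block [2..<n])"
  obtain z where z: "y n = Suc z"
    using assms(1) assms(3)[of n] by (cases "y n") auto
  \<comment> \<open>Only the last \<open>x 1 + 1\<close> ones of the final block enter the overlap;
    the surplus \<open>c\<close> goes to the part before it.\<close>
  obtain c where c: "x n = c + Suc (x 1)"
    using assms(4) by (metis Suc_eq_plus1 add.commute le_Suc_ex)
  have "[1..<Suc n] = 1 # [2..<n] @ [n]"
    using assms(1) by (simp add: upt_conv_Cons numeral_2_eq_2)
  then have f: "block_string n x y = ?block 1 @ M @ ?block n"
    unfolding block_string_def M_def by simp
  \<comment> \<open>The 1 after the opening zeros starts block 2, which is the final block if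
    \<open>n = 2\<close>.\<close>
  obtain v where v: "M @ ?block n = True # v"
  proof (cases "n = 2")
    case True
    then show ?thesis
      using that c by (simp add: M_def)
  next
    case False
    then have "[2..<n] = 2 # [3..<n]"
      using assms(1) by (simp add: upt_conv_Cons)
    moreover obtain k where "x 2 = Suc k"
      using assms(1) assms(2)[of 2] by (cases "x 2") auto
    ultimately show ?thesis
      using that by (simp add: M_def)
  qed
  have "length M = (\<Sum>i=2..n - 1. x i) + (\<Sum>i=2..n - 1. y i)"
  proof -
    have "length M = (\<Sum>i\<leftarrow>[2..<n]. x i + y i)"
      by (simp add: M_def length_concat comp_def)
    also have "\<dots> = (\<Sum>i=2..<n. x i + y i)"
      by (simp add: sum_list_distinct_conv_sum_set)
    also have "{2..<n} = {2..n - 1}"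
      using assms(1) by auto
    finally show ?thesis
      by (simp add: sum.distrib)
  qed
  moreover have "(\<Sum>i=2..n. x i) = (\<Sum>i=2..n - 1. x i) + x n"
    using assms(1) by (cases n) auto
  ultimately have len: "2 * length M + 2 * x n + 3 * y 1 + x 1 - 1 \<le> d"
    using assms(6) by simp
  show ?thesis
  proof (rule not_isometric_fibonacci_cube_overlap)
    show "block_string n x y =
        (?block 1 @ M @ replicate c True) @ replicate (x 1) True @ True # replicate z False @ [False]"
      by (simp add: f c z replicate_add replicate_append_same)
    show "block_string n x y =
        replicate (x 1) True @ False # replicate z False @ True # v"
      using v by (simp add: f assms(5)[simplified] z)
    have "length v + 1 = length M + x n + y n"
      using arg_cong[OF v, of length] by simp
    \<comment> \<open>Since \<open>y 1 = y n\<close>, the left side equals the bound in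
      \<open>len\<close> exactly; the \<open>- 1\<close> is the letter that \<open>v\<close>
      lacks.\<close>
    then show "length (block_string n x y) + length v \<le> d"
      using len assms(5) by (simp add: f)
  qed
qed

end
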